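(* Let $\mathbb{T}$ be a time scale, $a,b\in\mathbb{T}$ with $a<b$, and consider the optimal control problem $$J(x,u)=\int_a^b L(t,x(t),u(t))\,\Delta t\longrightarrow\min,\qquad x^{\Delta}(t)=\varphi(t,x(t),u(t)),\quad t\in[a,\rho(b)]_{\mathbb{T}},\qquad (P)$$ with $x\in C^1_{\mathrm{prd}}([a,b]_{\mathbb{T}})$ and $u\in C_{\mathrm{prd}}([a,\rho(b)]_{\mathbb{T}})$ real-valued. Let $h_s:[a,b]_{\mathbb{T}}\times\mathbb{R}^2\to\mathbb{R}$, $s\in(-\varepsilon,\varepsilon)$, be a one-parameter family of transformations and $\Phi_s(t,x,u)$ a family of functions, as specified in the context. If problem $(P)$ is invariant under the transformation $h_s(t,x,u)$ up to $\Phi_s(t,x,u)$, then for every extremal $(x,u,\lambda,p)$ of $(P)$ the expression $$p(t)\,\frac{\partial}{\partial s}h_s(t,x(t),u(t))\Big|_{s=0}+\lambda\,\frac{\partial}{\partial s}\Phi_s(t,x(t),u(t))\Big|_{s=0}$$ is constant in $t$.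
   Context: A time scale $\mathbb{T}$ is a nonempty closed subset of $\mathbb{R}$; $\sigma,\rho$ are its forward and backward jump operators, $\mu(t)=\sigma(t)-t$ its graininess, $f^\Delta$ (also written $\frac{\Delta}{\Delta t}f$) the delta derivative, $f^\sigma=f\circ\sigma$, and $\int\cdot\,\Delta t$ the delta integral. $[a,b]_{\mathbb{T}}:=[a,b]\cap\mathbb{T}$. A function is rd-continuous if it is continuous at right-dense points and has left-sided limits at left-dense points. $C_{\mathrm{prd}}$ is the class of piecewise rd-continuous functions (rd-continuous except possibly at finitely many points), and $f\in C^1_{\mathrm{prd}}$ means that $f$ is continuous and $f^\Delta$ exists and is rd-continuous except possibly at finitely many points. Admissible pair: a pair $(x,u)$, with $x\in C^1_{\mathrm{prd}}([a,b]_{\mathbb{T}})$ and $u\in C_{\mathrm{prd}}([a,\rho(b)]_{\mathbb{T}})$, satisfying $x^\Delta(t)=\varphi(t,x(t),u(t))$ for $t\in[a,\rho(b)]_{\mathbb{T}}$. Regularity: $L(t,\cdot,\cdot)$ and $\varphi(t,\cdot,\cdot)$ are differentiable in $(x,u)$; the partial derivatives $\frac{\partial L}{\partial x},\frac{\partial L}{\partial u},\frac{\partial\varphi}{\partial x},\frac{\partial\varphi}{\partial u}$ are continuous at $(x,u)$ uniformly in $t$ and rd-continuous in $t$ for any admissible $(x,u)$; and $1+\mu(t)\frac{\partial\varphi}{\partial x}\neq0$ for all $t\in[a,\rho(b)]_{\mathbb{T}}$. Extremal: a quadruple $(x,u,\lambda,p)$ with $(x,u)$ admissible, $\lambda\ge0$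 a constant, $p\in C^1_{\mathrm{prd}}$ on $[a,\rho(b)]_{\mathbb{T}}$, such that for all $t\in[a,\rho(b)]_{\mathbb{T}}$ $$-p^\Delta(t)=\frac{\partial\varphi}{\partial x}p^\sigma(t)+\lambda\frac{\partial L}{\partial x},\qquad \frac{\partial\varphi}{\partial u}p^\sigma(t)+\lambda\frac{\partial L}{\partial u}=0,$$ where the partial derivatives are evaluated at $(t,x(t),u(t))$. Family of transformations: the $h_s$, $s\in(-\varepsilon,\varepsilon)$, have continuous partial delta derivatives of first and second order with respect to $s$ and $t$ for all admissible $(x,u)$, i.e. $(s,t)\mapsto h_s(t,x(t),u(t))$ has them (so mixed partial delta derivatives are equal; the parameter $s$ is real, so the derivative in $s$ is the ordinary one), and $h_0(t,x,u)=x$ for all $(t,x,u)\in[a,b]_{\mathbb{T}}\times\mathbb{R}^2$. Invariance: $(P)$ is invariant under $h_s(t,x,u)$ up to $\Phi_s(t,x,u)$ if $\Phi_s(t,x,u)$ has continuous partial delta derivatives of first and second order with respect to $s$ and $t$ for all admissible $(x,u)$ (in the same sense), and for all $s\in(-\varepsilon,\varepsilon)$ and all admissible $(x,u)$ there is a control $u_s(\cdot)\in C_{\mathrm{prd}}[a,\rho(b)]_{\mathbb{T}}$ such that $$L(t,x(t),u(t))+\Phi_s^\Delta(t,x(t),u(t))=L(t,h_s(t,x(t),u(t)),u_s(t)),$$ $$\frac{\Delta}{\Delta t}h_s(t,x(t),u(t))=\varphi(t,h_s(t,x(t),u(t)),u_s(t)).$$ Here $\Phi_s^\Delta(t,x(t),u(t))$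 is the delta derivative in $t$ of $t\mapsto\Phi_s(t,x(t),u(t))$. It is assumed that $u_0(\cdot)=u(\cdot)$ and $\frac{\partial}{\partial s}u_s(\cdot)\in C_{\mathrm{prd}}[a,\rho(b)]_{\mathbb{T}}$. *)

theory Defs
  imports "HOL-Analysis.Analysis"
begin

section \<open>Time scales\<close>

definition time_scale :: "real set \<Rightarrow> bool" where
  "time_scale T \<longleftrightarrow> T \<noteq> {} \<and> closed T"

definition ts_ival :: "real set \<Rightarrow> real \<Rightarrow> real \<Rightarrow> real set" where
  "ts_ival T a b = {a..b} \<inter> T"

text \<open>The case distinctions implement the usual conventions that the forward jump fixes the
  maximum and the backward jump fixes the minimum of a time scale.\<close>

definition fjump :: "real set \<Rightarrow> real \<Rightarrow> real" where
  "fjump S t = (if \<exists>s\<in>S. t < s then Inf {s \<in> S. t < s} else t)"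

definition bjump :: "real set \<Rightarrow> real \<Rightarrow> real" where
  "bjump S t = (if \<exists>s\<in>S. s < t then Sup {s \<in> S. s < t} else t)"

definition graininess :: "real set \<Rightarrow> real \<Rightarrow> real" where
  "graininess S t = fjump S t - t"

definition right_dense :: "real set \<Rightarrow> real \<Rightarrow> bool" where
  "right_dense S t \<longleftrightarrow> t \<in> S \<and> (\<exists>s\<in>S. t < s) \<and> fjump S t = t"

definition left_dense :: "real set \<Rightarrow> real \<Rightarrow> bool" where
  "left_dense S t \<longleftrightarrow> t \<in> S \<and> (\<exists>s\<in>S. s < t) \<and> bjump S t = t"

definition has_delta_derivative :: "real set \<Rightarrow> (real \<Rightarrow> real) \<Rightarrow> real \<Rightarrow> real \<Rightarrow> bool" where
  "has_delta_derivative S f D t \<longleftrightarrow>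
     (\<forall>e>0. \<exists>d>0. \<forall>s\<in>S. \<bar>s - t\<bar> < d \<longrightarrow>
        \<bar>f (fjump S t) - f s - D * (fjump S t - s)\<bar> \<le> e * \<bar>fjump S t - s\<bar>)"

definition delta_differentiable :: "real set \<Rightarrow> (real \<Rightarrow> real) \<Rightarrow> real \<Rightarrow> bool" where
  "delta_differentiable S f t \<longleftrightarrow> (\<exists>D. has_delta_derivative S f D t)"

definition delta_deriv :: "real set \<Rightarrow> (real \<Rightarrow> real) \<Rightarrow> real \<Rightarrow> real" where
  "delta_deriv S f t = (SOME D. has_delta_derivative S f D t)"

definition rd_continuous_at :: "real set \<Rightarrow> (real \<Rightarrow> real) \<Rightarrow> real \<Rightarrow> bool" where
  "rd_continuous_at S f t \<longleftrightarrow>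
     (right_dense S t \<longrightarrow> continuous (at t within S) f) \<and>
     (left_dense S t \<longrightarrow> (\<exists>l. (f \<longlongrightarrow> l) (at t within (S \<inter> {..<t}))))"

definition rd_continuous_on :: "real set \<Rightarrow> (real \<Rightarrow> real) \<Rightarrow> bool" where
  "rd_continuous_on S f \<longleftrightarrow> (\<forall>t\<in>S. rd_continuous_at S f t)"

definition C_prd :: "real set \<Rightarrow> (real \<Rightarrow> real) \<Rightarrow> bool" where
  "C_prd S f \<longleftrightarrow> (\<exists>F. finite F \<and> (\<forall>t\<in>S - F. rd_continuous_at S f t))"

text \<open>Functions on \<open>[a,b]\<close> are differentiated relative to the time scale \<open>ts_ival T a b\<close>, so
  that no value outside \<open>[a,b]\<close> is used; the derivative lives on \<open>[a, \<rho>(b)]\<close>. Hence \<open>C1_prd T a b\<close>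
  is both the state space on \<open>[a,b]\<close> and the class of multipliers on \<open>[a, \<rho>(b)]\<close>: the derivative
  at a left-scattered \<open>\<rho>(b)\<close> involves the value at \<open>b\<close>, where continuity is then automatic.\<close>

definition C1_prd :: "real set \<Rightarrow> real \<Rightarrow> real \<Rightarrow> (real \<Rightarrow> real) \<Rightarrow> bool" where
  "C1_prd T a b f \<longleftrightarrow>
     continuous_on (ts_ival T a b) f \<and>
     (\<exists>F. finite F \<and>
        (\<forall>t\<in>ts_ival T a (bjump T b) - F.
           delta_differentiable (ts_ival T a b) f t \<and>
           rd_continuous_at (ts_ival T a (bjump T b)) (delta_deriv (ts_ival T a b) f) t))"

text \<open>All first and second order partial derivatives of \<open>g s t\<close>, ordinary in \<open>s\<close> and delta in \<open>t\<close>,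
  exist and are jointly continuous; each delta differentiation in \<open>t\<close> moves the right end point
  of the domain one backward jump to the left.\<close>

definition C2_partial :: "real set \<Rightarrow> real \<Rightarrow> real \<Rightarrow> real \<Rightarrow> (real \<Rightarrow> real \<Rightarrow> real) \<Rightarrow> bool" where
  "C2_partial T a b \<epsilon> g \<longleftrightarrow>
     (let P = {-\<epsilon><..<\<epsilon>};
          I0 = ts_ival T a b;
          I1 = ts_ival T a (bjump T b);
          I2 = ts_ival T a (bjump T (bjump T b))
      in \<exists>g_s g_t g_ss g_st g_ts g_tt.
        (\<forall>s\<in>P. \<forall>t\<in>I0. ((\<lambda>r. g r t) has_real_derivative g_s s t) (at s)) \<and>
        (\<forall>s\<in>P. \<forall>t\<in>I1. has_delta_derivative I0 (g s) (g_t s t) t) \<and>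
        (\<forall>s\<in>P. \<forall>t\<in>I0. ((\<lambda>r. g_s r t) has_real_derivative g_ss s t) (at s)) \<and>
        (\<forall>s\<in>P. \<forall>t\<in>I1. has_delta_derivative I0 (g_s s) (g_st s t) t) \<and>
        (\<forall>s\<in>P. \<forall>t\<in>I1. ((\<lambda>r. g_t r t) has_real_derivative g_ts s t) (at s)) \<and>
        (\<forall>s\<in>P. \<forall>t\<in>I2. has_delta_derivative I1 (g_t s) (g_tt s t) t) \<and>
        continuous_on (P \<times> I0) (\<lambda>(s, t). g_s s t) \<and>
        continuous_on (P \<times> I1) (\<lambda>(s, t). g_t s t) \<and>
        continuous_on (P \<times> I0) (\<lambda>(s, t). g_ss s t) \<and>
        continuous_on (P \<times> I1) (\<lambda>(s, t). g_st s t) \<and>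
        continuous_on (P \<times> I1) (\<lambda>(s, t). g_ts s t) \<and>
        continuous_on (P \<times> I2) (\<lambda>(s, t). g_tt s t))"

section \<open>The optimal control problem\<close>

text \<open>The problem is given by \<open>T\<close>, \<open>a\<close>, \<open>b\<close>, the integrand \<open>L t x u\<close> and the dynamics \<open>\<phi> t x u\<close>;
  the notions below depend on the objective (the delta integral of \<open>L\<close>) only through \<open>L\<close>.

  Equations containing a delta derivative of a piecewise smooth function are required at every
  point where that derivative exists, i.e. off a finite set (it need not exist where \<open>u\<close> jumps).\<close>

definition pd_x :: "(real \<Rightarrow> real \<Rightarrow> real \<Rightarrow> real) \<Rightarrow> real \<Rightarrow> real \<Rightarrow> real \<Rightarrow> real" where
  "pd_x f t y v = deriv (\<lambda>z. f t z v) y"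

definition pd_u :: "(real \<Rightarrow> real \<Rightarrow> real \<Rightarrow> real) \<Rightarrow> real \<Rightarrow> real \<Rightarrow> real \<Rightarrow> real" where
  "pd_u f t y v = deriv (\<lambda>w. f t y w) v"

definition admissible ::
  "real set \<Rightarrow> real \<Rightarrow> real \<Rightarrow> (real \<Rightarrow> real \<Rightarrow> real \<Rightarrow> real) \<Rightarrow> (real \<Rightarrow> real) \<Rightarrow> (real \<Rightarrow> real) \<Rightarrow> bool"
where
  "admissible T a b \<phi> x u \<longleftrightarrow>
     C1_prd T a b x \<and> C_prd (ts_ival T a (bjump T b)) u \<and>
     (\<forall>t\<in>ts_ival T a (bjump T b). delta_differentiable (ts_ival T a b) x t \<longrightarrow>
        delta_deriv (ts_ival T a b) x t = \<phi> t (x t) (u t))"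

definition continuous_unif_t ::
  "real set \<Rightarrow> (real \<Rightarrow> real \<Rightarrow> real \<Rightarrow> real) \<Rightarrow> (real \<Rightarrow> real) \<Rightarrow> (real \<Rightarrow> real) \<Rightarrow> bool" where
  "continuous_unif_t S f x u \<longleftrightarrow>
     (\<forall>e>0. \<exists>d>0. \<forall>t\<in>S. \<forall>y v.
        dist (y, v) (x t, u t) < d \<longrightarrow> \<bar>f t y v - f t (x t) (u t)\<bar> < e)"

text \<open>Rd-continuity in \<open>t\<close> refers to the first argument, the other two being frozen at a value
  taken by an admissible pair; along the pair itself one only gets piecewise rd-continuity, since
  \<open>u\<close> is only piecewise rd-continuous.\<close>

definition regular_problem ::
  "real set \<Rightarrow> real \<Rightarrow> real \<Rightarrow> (real \<Rightarrow> real \<Rightarrow> real \<Rightarrow> real) \<Rightarrow> (real \<Rightarrow> real \<Rightarrow> real \<Rightarrow> real) \<Rightarrow> bool"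
where
  "regular_problem T a b L \<phi> \<longleftrightarrow>
     (let I = ts_ival T a (bjump T b) in
       (\<forall>t\<in>I. \<forall>z. (\<lambda>(y, v). L t y v) differentiable (at z) \<and>
                   (\<lambda>(y, v). \<phi> t y v) differentiable (at z)) \<and>
       (\<forall>x u. admissible T a b \<phi> x u \<longrightarrow>
          (\<forall>f \<in> {pd_x L, pd_u L, pd_x \<phi>, pd_u \<phi>}.
             continuous_unif_t I f x u \<and>
             (\<forall>\<tau>\<in>I. rd_continuous_on I (\<lambda>t. f t (x \<tau>) (u \<tau>)))) \<and>
          (\<forall>t\<in>I. 1 + graininess (ts_ival T a b) t * pd_x \<phi> t (x t) (u t) \<noteq> 0)))"

definition extremal ::
  "real set \<Rightarrow> real \<Rightarrow> real \<Rightarrow> (real \<Rightarrow> real \<Rightarrow> real \<Rightarrow> real) \<Rightarrow> (real \<Rightarrow> real \<Rightarrow> real \<Rightarrow> real) \<Rightarrow>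
   (real \<Rightarrow> real) \<Rightarrow> (real \<Rightarrow> real) \<Rightarrow> real \<Rightarrow> (real \<Rightarrow> real) \<Rightarrow> bool"
where
  "extremal T a b L \<phi> x u lam p \<longleftrightarrow>
     admissible T a b \<phi> x u \<and> 0 \<le> lam \<and> C1_prd T a b p \<and>
     (\<forall>t\<in>ts_ival T a (bjump T b).
        (delta_differentiable (ts_ival T a b) p t \<longrightarrow>
           - delta_deriv (ts_ival T a b) p t =
             pd_x \<phi> t (x t) (u t) * p (fjump (ts_ival T a b) t) + lam * pd_x L t (x t) (u t)) \<and>
        pd_u \<phi> t (x t) (u t) * p (fjump (ts_ival T a b) t) + lam * pd_u L t (x t) (u t) = 0)"

section \<open>Invariance\<close>

text \<open>When \<open>b\<close> is left-scattered, \<open>u b\<close> is unconstrained by admissibility but occurs in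
  \<open>h s b (x b) (u b)\<close>; the conditions below then range over all its values.\<close>

definition transformation_family ::
  "real set \<Rightarrow> real \<Rightarrow> real \<Rightarrow> (real \<Rightarrow> real \<Rightarrow> real \<Rightarrow> real) \<Rightarrow> real \<Rightarrow>
   (real \<Rightarrow> real \<Rightarrow> real \<Rightarrow> real \<Rightarrow> real) \<Rightarrow> bool"
where
  "transformation_family T a b \<phi> \<epsilon> h \<longleftrightarrow>
     (\<forall>x u. admissible T a b \<phi> x u \<longrightarrow> C2_partial T a b \<epsilon> (\<lambda>s t. h s t (x t) (u t))) \<and>
     (\<forall>t\<in>ts_ival T a b. \<forall>y v. h 0 t y v = y)"

definition invariant_up_to ::
  "real set \<Rightarrow> real \<Rightarrow> real \<Rightarrow> (real \<Rightarrow> real \<Rightarrow> real \<Rightarrow> real) \<Rightarrow> (real \<Rightarrow> real \<Rightarrow> real \<Rightarrow> real) \<Rightarrow> real \<Rightarrow>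
   (real \<Rightarrow> real \<Rightarrow> real \<Rightarrow> real \<Rightarrow> real) \<Rightarrow> (real \<Rightarrow> real \<Rightarrow> real \<Rightarrow> real \<Rightarrow> real) \<Rightarrow> bool"
where
  "invariant_up_to T a b L \<phi> \<epsilon> h \<Phi> \<longleftrightarrow>
     (let I0 = ts_ival T a b; I1 = ts_ival T a (bjump T b) in
       \<forall>x u. admissible T a b \<phi> x u \<longrightarrow>
         C2_partial T a b \<epsilon> (\<lambda>s t. \<Phi> s t (x t) (u t)) \<and>
         (\<exists>us :: real \<Rightarrow> real \<Rightarrow> real.
            (\<forall>t\<in>I1. us 0 t = u t) \<and>
            (\<forall>s\<in>{-\<epsilon><..<\<epsilon>}.
               C_prd I1 (us s) \<and>
               (\<forall>t\<in>I1. (\<lambda>r. us r t) differentiable (at s)) \<and>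
               C_prd I1 (\<lambda>t. deriv (\<lambda>r. us r t) s) \<and>
               (\<forall>t\<in>I1.
                  L t (x t) (u t) + delta_deriv I0 (\<lambda>\<tau>. \<Phi> s \<tau> (x \<tau>) (u \<tau>)) t
                    = L t (h s t (x t) (u t)) (us s t) \<and>
                  delta_deriv I0 (\<lambda>\<tau>. h s \<tau> (x \<tau>) (u \<tau>)) t
                    = \<phi> t (h s t (x t) (u t)) (us s t)))))"

end

theory Submission
  imports Defs
begin

text \<open>
  Along an extremal write \<open>\<xi> t\<close> and \<open>\<eta> t\<close> for the derivatives at \<open>s = 0\<close> of \<open>h s t (x t) (u t)\<close>
  and \<open>\<Phi> s t (x t) (u t)\<close>, and \<open>w t\<close> for that of the transformed control given by invariance.
  Differentiating the two invariance identities with respect to \<open>s\<close> at \<open>0\<close>, and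
  interchanging this with the delta derivative, gives the linearised equations \<open>\<eta>\<^sup>\<Delta> = L\<^sub>x \<xi> + L\<^sub>u w\<close> and
  \<open>\<xi>\<^sup>\<Delta> = \<phi>\<^sub>x \<xi> + \<phi>\<^sub>u w\<close> (\<open>linearised_invariance\<close>). With the product rule
  \<open>(p \<xi>)\<^sup>\<Delta> = p\<^sup>\<Delta> \<xi> + p\<^sup>\<sigma> \<xi>\<^sup>\<Delta>\<close>, the costate equation cancels the terms in \<open>\<xi>\<close> and the
  stationarity condition those in \<open>w\<close>, so \<open>p \<xi> + lam \<eta>\<close> has delta derivative \<open>0\<close> wherever \<open>p\<close> is
  delta differentiable.

  Two facts carry the analysis. The mean value inequality \<open>delta_mean_value_inequality\<close> admits
  finitely many right-dense exceptional points; that is all that is needed, because a continuous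
  function is delta differentiable at every right-scattered point. It yields constancy of the
  conserved quantity. Applied to \<open>g s - g s\<^sub>0\<close> minus a function linear in \<open>t\<close>, it also yields
  \<open>has_delta_derivative_partial_deriv\<close>, the interchange of the two derivatives.

  The right end point \<open>b\<close> never needs to be considered as a point of differentiation: constancy
  only uses delta derivatives at points \<open>t < b\<close>, where moreover they are unique.
\<close>

section \<open>Delta derivatives at right-scattered and right-dense points\<close>

lemma fjump_ge: "t \<le> fjump S t"
  unfolding fjump_def by (auto intro!: cInf_greatest)

lemma fjump_le:
  assumes "s \<in> S" "t < s"
  shows "fjump S t \<le> s"
proof -
  have "bdd_below {s \<in> S. t < s}" by (rule bdd_belowI[of _ t]) auto
  then show ?thesis
    using assms unfolding fjump_def by (auto intro!: cInf_lower)
qed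

lemma fjump_mem:
  assumes "closed S" "t \<in> S"
  shows "fjump S t \<in> S"
proof (cases "\<exists>s\<in>S. t < s")
  case True
  have "Inf {s \<in> S. t < s} \<in> closure {s \<in> S. t < s}"
    using True by (intro closure_contains_Inf bdd_belowI[of _ t]) auto
  also have "\<dots> \<subseteq> S"
    using assms(1) by (intro closure_minimal) auto
  finally show ?thesis using True by (simp add: fjump_def)
qed (use assms in \<open>simp add: fjump_def\<close>)

lemma right_dense_ex:
  assumes "fjump S t = t" "s \<in> S" "t < s" "0 < d"
  obtains r where "r \<in> S" "t < r" "r < t + d"
proof -
  have ne: "{s \<in> S. t < s} \<noteq> {}" using assms by auto
  have "Inf {s \<in> S. t < s} < t + d"
    using assms unfolding fjump_def by (auto split: if_splits)
  from cInf_lessD[OF ne this] show ?thesis using that by auto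
qed

text \<open>At a right-scattered point the delta derivative is the difference quotient over the jump,
  and delta differentiability amounts to continuity.\<close>

lemma has_delta_derivative_scattered:
  assumes "t \<in> S" "t < fjump S t"
  shows "has_delta_derivative S f D t \<longleftrightarrow>
    continuous (at t within S) f \<and> f (fjump S t) - f t = D * (fjump S t - t)"
    (is "_ \<longleftrightarrow> ?R")
proof
  let ?m = "fjump S t - t"
  assume H: "has_delta_derivative S f D t"
  have "\<bar>f (fjump S t) - f t - D * ?m\<bar> \<le> 0"
  proof (rule field_le_epsilon)
    fix e :: real assume "0 < e"
    then have "0 < e / ?m" using assms by simp
    with H obtain d where "d > 0" and
      "\<forall>s\<in>S. \<bar>s - t\<bar> < d \<longrightarrow>
        \<bar>f (fjump S t) - f s - D * (fjump S t - s)\<bar> \<le> e / ?m * \<bar>fjump S t - s\<bar>"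
      unfolding has_delta_derivative_def by blast
    then have "\<bar>f (fjump S t) - f t - D * ?m\<bar> \<le> e / ?m * \<bar>?m\<bar>"
      using assms(1) by fastforce
    then show "\<bar>f (fjump S t) - f t - D * ?m\<bar> \<le> 0 + e"
      using assms(2) by simp
  qed
  then have eq: "f (fjump S t) - f t = D * ?m" by simp
  \<comment> \<open>Subtracting the linear part leaves a function whose values at \<open>t\<close> and at the jump agree.\<close>
  have "continuous (at t within S) (\<lambda>s. f s - D * s)"
    unfolding continuous_within_eps_delta
  proof (intro allI impI)
    fix e :: real assume "0 < e"
    then have "0 < e / (3 * ?m)" using assms(2) by simp
    with H obtain d where "d > 0" and
      d: "\<And>s. s \<in> S \<Longrightarrow> \<bar>s - t\<bar> < d \<Longrightarrow>
        \<bar>f (fjump S t) - f s - D * (fjump S t - s)\<bar> \<le> e / (3 * ?m) * \<bar>fjump S t - s\<bar>"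
      unfolding has_delta_derivative_def by meson
    have "dist (f s - D * s) (f t - D * t) < e" if s: "s \<in> S" "dist s t < min d ?m" for s
    proof -
      have near: "\<bar>s - t\<bar> < d" "\<bar>s - t\<bar> < ?m"
        using s(2) unfolding dist_real_def by linarith+
      have "dist (f s - D * s) (f t - D * t) = \<bar>(f t - D * t) - (f s - D * s)\<bar>"
        unfolding dist_real_def by (rule abs_minus_commute)
      also have "(f t - D * t) - (f s - D * s) = f (fjump S t) - f s - D * (fjump S t - s)"
        using eq by (simp add: algebra_simps)
      also have "\<bar>\<dots>\<bar> \<le> e / (3 * ?m) * \<bar>fjump S t - s\<bar>"
        using d[OF s(1) near(1)] .
      also have "\<dots> < e / (3 * ?m) * (3 * ?m)"
        using near(2) by (intro mult_strict_left_mono \<open>0 < e / (3 * ?m)\<close>) (simp add: abs_less_iff)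
      also have "\<dots> = e" using assms(2) by simp
      finally show ?thesis .
    qed
    moreover have "0 < min d ?m" using \<open>d > 0\<close> assms(2) by simp
    ultimately show "\<exists>d>0. \<forall>s\<in>S. dist s t < d \<longrightarrow> dist (f s - D * s) (f t - D * t) < e"
      by (intro exI[of _ "min d ?m"] conjI ballI impI)
  qed
  then have "continuous (at t within S) (\<lambda>s. (f s - D * s) + D * s)"
    by (rule continuous_add) (intro continuous_intros)
  then have "continuous (at t within S) f" by (simp only: diff_add_cancel)
  with eq show ?R by simp
next
  let ?m = "fjump S t - t"
  assume R: ?R
  show "has_delta_derivative S f D t"
    unfolding has_delta_derivative_def
  proof (intro allI impI)
    fix e :: real assume e: "0 < e"
    have lin: "continuous (at t within S) (\<lambda>s. f s - D * s)"
      using R by (intro continuous_intros) auto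
    have "0 < e * ?m" using e assms by simp
    with lin obtain d where d: "d > 0" and
      H: "\<And>s. s \<in> S \<Longrightarrow> dist s t < d \<Longrightarrow> dist (f s - D * s) (f t - D * t) < e * ?m"
      unfolding continuous_within_eps_delta by meson
    have "\<bar>f (fjump S t) - f s - D * (fjump S t - s)\<bar> \<le> e * \<bar>fjump S t - s\<bar>"
      if s: "s \<in> S" "\<bar>s - t\<bar> < min d ?m" for s
    proof -
      have "s \<le> t" using fjump_le[OF s(1), of t] s(2) by linarith
      have "f (fjump S t) - f s - D * (fjump S t - s) = (f t - D * t) - (f s - D * s)"
        using R by (simp add: algebra_simps)
      then have "\<bar>f (fjump S t) - f s - D * (fjump S t - s)\<bar> \<le> e * ?m"
        using less_imp_le[OF H[OF s(1)]] s(2)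
        by (simp only: dist_real_def min_less_iff_conj abs_minus_commute)
      also have "\<dots> \<le> e * \<bar>fjump S t - s\<bar>"
        using \<open>s \<le> t\<close> e by (intro mult_left_mono) linarith+
      finally show ?thesis .
    qed
    then show "\<exists>d>0. \<forall>s\<in>S. \<bar>s - t\<bar> < d \<longrightarrow>
        \<bar>f (fjump S t) - f s - D * (fjump S t - s)\<bar> \<le> e * \<bar>fjump S t - s\<bar>"
      using d assms(2) by (intro exI[of _ "min d ?m"]) auto
  qed
qed

lemma has_delta_derivative_dense:
  assumes "fjump S t = t"
  shows "has_delta_derivative S f D t \<longleftrightarrow> (f has_real_derivative D) (at t within S)"
proof -
  have "\<bar>f t - f s - D * (t - s)\<bar> = norm (f s - f t - D * (s - t))"
       "\<bar>t - s\<bar> = norm (s - t)" for s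
    by (simp_all add: algebra_simps abs_minus_commute)
  then show ?thesis
    unfolding has_delta_derivative_def has_field_derivative_def has_derivative_within_alt assms
    by (simp add: bounded_linear_mult_right abs_minus_commute)
qed

lemma has_delta_derivative_continuous:
  assumes "t \<in> S" "has_delta_derivative S f D t"
  shows "continuous (at t within S) f"
proof (cases "fjump S t = t")
  case True
  then show ?thesis using assms(2) by (auto simp: has_delta_derivative_dense intro: DERIV_continuous)
next
  case False
  then have "t < fjump S t" using fjump_ge[of t S] by simp
  then show ?thesis using assms by (simp add: has_delta_derivative_scattered)
qed

lemma has_delta_derivative_unique:
  assumes "t \<in> S" "s \<in> S" "t < s"
    and "has_delta_derivative S f D t" "has_delta_derivative S f D' t"
  shows "D = D'"
proof (cases "fjump S t = t")
  case True
  have "t islimpt S"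
    unfolding islimpt_approachable
  proof (intro allI impI)
    fix e :: real assume "0 < e"
    then obtain x' where "x' \<in> S" "t < x'" "x' < t + e"
      using right_dense_ex[OF True assms(2,3)] by blast
    then show "\<exists>x'\<in>S. x' \<noteq> t \<and> dist x' t < e"
      by (intro bexI[of _ x']) (auto simp: dist_real_def)
  qed
  then have "at t within S \<noteq> bot" by (simp add: trivial_limit_within)
  then show ?thesis
    using assms(4,5) unfolding has_delta_derivative_dense[OF True] has_field_derivative_iff
    by (rule tendsto_unique)
next
  case False
  then have "t < fjump S t" using fjump_ge[of t S] by simp
  then show ?thesis
    using assms(4,5) has_delta_derivative_scattered[OF assms(1), of f] by auto
qed

lemma delta_deriv_eq:
  assumes "t \<in> S" "s \<in> S" "t < s" "has_delta_derivative S f D t"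
  shows "delta_deriv S f t = D"
  unfolding delta_deriv_def
proof (rule some_equality)
  show "has_delta_derivative S f D t" by fact
  show "D' = D" if "has_delta_derivative S f D' t" for D'
    using has_delta_derivative_unique[OF assms(1-3) that assms(4)] .
qed

lemma delta_differentiable_scattered:
  assumes "t \<in> S" "t < fjump S t" "continuous (at t within S) f"
  shows "delta_differentiable S f t"
  unfolding delta_differentiable_def
proof
  show "has_delta_derivative S f ((f (fjump S t) - f t) / (fjump S t - t)) t"
    using assms by (simp add: has_delta_derivative_scattered)
qed

lemma has_delta_derivative_mult:
  assumes t: "t \<in> S" and f: "has_delta_derivative S f D t" and g: "has_delta_derivative S g E t"
  shows "has_delta_derivative S (\<lambda>t. f t * g t) (D * g t + f (fjump S t) * E) t"
proof (cases "fjump S t = t")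
  case True
  then show ?thesis
    using f g DERIV_mult'[of f D t S g E]
    by (simp add: has_delta_derivative_dense algebra_simps)
next
  case False
  then have *: "t < fjump S t" using fjump_ge[of t S] by simp
  have eqs: "f (fjump S t) = f t + D * (fjump S t - t)" "g (fjump S t) = g t + E * (fjump S t - t)"
    using f g t * by (simp_all add: has_delta_derivative_scattered algebra_simps)
  show ?thesis
    using f g t * unfolding has_delta_derivative_scattered[OF t *]
    by (auto intro!: continuous_intros simp: eqs algebra_simps)
qed

lemma has_delta_derivative_add:
  assumes t: "t \<in> S" and f: "has_delta_derivative S f D t" and g: "has_delta_derivative S g E t"
  shows "has_delta_derivative S (\<lambda>t. f t + g t) (D + E) t"
proof (cases "fjump S t = t")
  case True
  then show ?thesis using f g by (auto simp: has_delta_derivative_dense intro: DERIV_add)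
next
  case False
  then have *: "t < fjump S t" using fjump_ge[of t S] by simp
  show ?thesis
    using f g unfolding has_delta_derivative_scattered[OF t *]
    by (auto intro!: continuous_intros simp: algebra_simps)
qed

lemma has_delta_derivative_const: "has_delta_derivative S (\<lambda>t. c) 0 t"
  unfolding has_delta_derivative_def by (auto intro: exI[of _ 1])

lemma has_delta_derivative_ident: "has_delta_derivative S (\<lambda>t. t) 1 t"
  unfolding has_delta_derivative_def by (auto intro: exI[of _ 1])

lemma has_delta_derivative_cmult:
  assumes "t \<in> S" "has_delta_derivative S f D t"
  shows "has_delta_derivative S (\<lambda>t. c * f t) (c * D) t"
  using has_delta_derivative_mult[OF assms(1) has_delta_derivative_const[of S c t] assms(2)] by simp

section \<open>The mean value inequality\<close>

text \<open>The induction principle on a closed set of reals. It holds because the supremum of the points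
  up to which \<open>P\<close> is true inherits \<open>P\<close> by \<open>limit\<close>, and if it lay before \<open>q\<close>, one of the other
  two steps would carry \<open>P\<close> past it.\<close>

lemma time_scale_induct:
  fixes P :: "real \<Rightarrow> bool"
  assumes S: "closed S" and r: "r \<in> S" and q: "q \<in> S" and "r \<le> q" and start: "P r"
    and jump: "\<And>t. t \<in> S \<Longrightarrow> r \<le> t \<Longrightarrow> t < q \<Longrightarrow> P t \<Longrightarrow> t < fjump S t \<Longrightarrow> P (fjump S t)"
    and dense: "\<And>t. t \<in> S \<Longrightarrow> r \<le> t \<Longrightarrow> t < q \<Longrightarrow> P t \<Longrightarrow> fjump S t = t \<Longrightarrow>
      \<exists>d>0. \<forall>\<tau>\<in>S. t < \<tau> \<and> \<tau> < t + d \<and> \<tau> \<le> q \<longrightarrow> P \<tau>"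
    and limit: "\<And>t. t \<in> S \<Longrightarrow> r < t \<Longrightarrow> t \<le> q \<Longrightarrow>
      (\<And>d. 0 < d \<Longrightarrow> \<exists>\<tau>\<in>S. r \<le> \<tau> \<and> \<tau> < t \<and> t - d < \<tau> \<and> P \<tau>) \<Longrightarrow> P t"
  shows "P q"
proof -
  define A where "A = {t \<in> S. r \<le> t \<and> t \<le> q \<and> (\<forall>\<tau>\<in>S. r \<le> \<tau> \<and> \<tau> \<le> t \<longrightarrow> P \<tau>)}"
  define c where "c = Sup A"
  have A_iff: "t \<in> A \<longleftrightarrow> t \<in> S \<and> r \<le> t \<and> t \<le> q \<and> (\<forall>\<tau>\<in>S. r \<le> \<tau> \<and> \<tau> \<le> t \<longrightarrow> P \<tau>)" for t
    by (simp add: A_def)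
  have rA: "r \<in> A" unfolding A_iff using r \<open>r \<le> q\<close> start by (auto dest: order_antisym)
  have bdd: "bdd_above A" by (rule bdd_aboveI[of _ q]) (simp add: A_iff)
  have upper: "t \<le> c" if "t \<in> A" for t unfolding c_def using that bdd by (rule cSup_upper)
  have rc: "r \<le> c" using rA by (rule upper)
  have cq: "c \<le> q" unfolding c_def
  proof (rule cSup_least)
    show "A \<noteq> {}" using rA by blast
  qed (simp add: A_iff)
  have ex: "\<exists>t\<in>A. y < t" if "y < c" for y
    using less_cSupD[of A y] rA that unfolding c_def by blast
  have cS: "c \<in> S"
  proof -
    have "c \<in> closure A" unfolding c_def using rA bdd by (intro closure_contains_Sup) blast+
    also have "\<dots> \<subseteq> S" by (rule closure_minimal[OF _ S]) (auto simp: A_iff)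
    finally show ?thesis .
  qed
  have below: "P \<tau>" if "\<tau> \<in> S" "r \<le> \<tau>" "\<tau> < c" for \<tau>
  proof -
    from ex[OF that(3)] obtain t where "t \<in> A" "\<tau> < t" by blast
    then show ?thesis using that(1,2) by (simp add: A_iff)
  qed
  have Pc: "P c"
  proof (cases "c \<in> A")
    case True
    then show ?thesis using rc unfolding A_iff by blast
  next
    case False
    then have "r \<noteq> c" using rA by blast
    have "\<exists>\<tau>\<in>S. r \<le> \<tau> \<and> \<tau> < c \<and> c - d < \<tau> \<and> P \<tau>" if "0 < d" for d
    proof -
      have "c - d < c" using that by simp
      from ex[OF this] obtain t where t: "t \<in> A" "c - d < t" by blast
      then have "t < c" using upper[OF t(1)] False by (cases "t = c") auto
      then show ?thesis using t unfolding A_iff by blast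
    qed
    then show ?thesis using limit[OF cS _ cq] rc \<open>r \<noteq> c\<close> by simp
  qed
  have no: False
    if t: "t \<in> S" "c < t" "t \<le> q" and P: "\<And>\<tau>. \<tau> \<in> S \<Longrightarrow> c < \<tau> \<Longrightarrow> \<tau> \<le> t \<Longrightarrow> P \<tau>" for t
  proof -
    have "P \<tau>" if "\<tau> \<in> S" "r \<le> \<tau>" "\<tau> \<le> t" for \<tau>
      using P[of \<tau>] below[of \<tau>] Pc that by (cases \<tau> c rule: linorder_cases) auto
    then have "t \<in> A" unfolding A_iff using t rc by simp
    then show False using upper[of t] t(2) by simp
  qed
  have "c = q"
  proof (rule ccontr)
    assume "c \<noteq> q"
    then have "c < q" using cq by simp
    show False
    proof (cases "fjump S c = c")
      case True
      from dense[OF cS rc \<open>c < q\<close> Pc True] obtain d where "d > 0" and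
        d: "\<forall>\<tau>\<in>S. c < \<tau> \<and> \<tau> < c + d \<and> \<tau> \<le> q \<longrightarrow> P \<tau>" by blast
      have "0 < min d (q - c)" using \<open>d > 0\<close> \<open>c < q\<close> by simp
      from right_dense_ex[OF True q \<open>c < q\<close> this]
      obtain t where t: "t \<in> S" "c < t" "t < c + min d (q - c)" .
      then have "t < c + d" "t < q" by linarith+
      then show False using no[OF t(1,2)] d by simp
    next
      case False
      then have lt: "c < fjump S c" using fjump_ge[of c S] by simp
      have "P \<tau>" if "\<tau> \<in> S" "c < \<tau>" "\<tau> \<le> fjump S c" for \<tau>
        using jump[OF cS rc \<open>c < q\<close> Pc lt] fjump_le[OF that(1,2)] that(3)
        by (simp add: order_antisym)
      then show False using no[OF fjump_mem[OF S cS] lt fjump_le[OF q \<open>c < q\<close>]] by blast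
    qed
  qed
  then show ?thesis using Pc by simp
qed

text \<open>The mean value inequality with a margin: \<open>f\<close> moves away from \<open>f r\<close> by at most
  \<open>(M + e) (\<tau> - r)\<close>, plus \<open>e\<close> for each exceptional point already passed. The extra \<open>e\<close> is what
  carries the induction past a right-dense exceptional point, where only continuity is known.\<close>

lemma delta_mean_value_inequality_margin:
  fixes f :: "real \<Rightarrow> real"
  assumes S: "closed S" and r: "r \<in> S" and q: "q \<in> S" and "r \<le> q" and "finite F"
    and cont: "continuous_on (S \<inter> {r..q}) f"
    and dense: "\<And>t. t \<in> F \<Longrightarrow> fjump S t = t"
    and deriv: "\<And>t. t \<in> S \<Longrightarrow> r \<le> t \<Longrightarrow> t < q \<Longrightarrow> t \<notin> F \<Longrightarrow>
      \<exists>D. has_delta_derivative S f D t \<and> \<bar>D\<bar> \<le> M"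
    and "0 \<le> M" and e: "0 < e"
  shows "\<bar>f q - f r\<bar> \<le> (M + e) * (q - r) + e * card (F \<inter> {r..<q})"
proof -
  define B where "B \<tau> = (M + e) * (\<tau> - r) + e * card (F \<inter> {r..<\<tau>})" for \<tau>
  have Me: "0 \<le> M + e" using \<open>0 \<le> M\<close> e by simp
  have B_mono: "B \<tau> + (M + e) * (\<tau>' - \<tau>) \<le> B \<tau>'" if "\<tau> \<le> \<tau>'" for \<tau> \<tau>'
  proof -
    have "card (F \<inter> {r..<\<tau>}) \<le> card (F \<inter> {r..<\<tau>'})"
      by (rule card_mono) (use that \<open>finite F\<close> in auto)
    then have "e * card (F \<inter> {r..<\<tau>}) \<le> e * card (F \<inter> {r..<\<tau>'})" using e by simp
    moreover have "(M + e) * (\<tau> - r) + (M + e) * (\<tau>' - \<tau>) = (M + e) * (\<tau>' - r)"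
      by (simp flip: distrib_left)
    ultimately show ?thesis unfolding B_def by linarith
  qed
  have B_jump: "B \<tau> + e \<le> B \<tau>'" if "\<tau> < \<tau>'" "\<tau> \<in> F" "r \<le> \<tau>" for \<tau> \<tau>'
  proof -
    have "Suc (card (F \<inter> {r..<\<tau>})) = card (insert \<tau> (F \<inter> {r..<\<tau>}))"
      using \<open>finite F\<close> by simp
    also have "\<dots> \<le> card (F \<inter> {r..<\<tau>'})"
      by (rule card_mono) (use that \<open>finite F\<close> in auto)
    finally have "card (F \<inter> {r..<\<tau>}) + (1::real) \<le> card (F \<inter> {r..<\<tau>'})" by simp
    from mult_left_mono[OF this, of e] have
      "e * card (F \<inter> {r..<\<tau>}) + e \<le> e * card (F \<inter> {r..<\<tau>'})"
      using e unfolding distrib_left by simp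
    moreover have "(M + e) * (\<tau> - r) \<le> (M + e) * (\<tau>' - r)"
      using that(1) Me by (intro mult_left_mono) simp_all
    ultimately show ?thesis unfolding B_def by linarith
  qed
  have step: "\<bar>f \<tau>' - f r\<bar> \<le> B \<tau>'"
    if "\<bar>f \<tau> - f r\<bar> \<le> B \<tau>" "\<tau> \<le> \<tau>'" "\<bar>f \<tau>' - f \<tau>\<bar> \<le> (M + e) * (\<tau>' - \<tau>)" for \<tau> \<tau>'
  proof -
    have "\<bar>f \<tau>' - f r\<bar> \<le> \<bar>f \<tau> - f r\<bar> + \<bar>f \<tau>' - f \<tau>\<bar>" by arith
    also have "\<dots> \<le> B \<tau> + (M + e) * (\<tau>' - \<tau>)" by (rule add_mono[OF that(1,3)])
    also have "\<dots> \<le> B \<tau>'" by (rule B_mono[OF that(2)])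
    finally show ?thesis .
  qed
  have close: "\<exists>d>0. \<forall>\<tau>\<in>S. r \<le> \<tau> \<and> \<tau> \<le> q \<and> \<bar>\<tau> - c\<bar> < d \<longrightarrow> \<bar>f \<tau> - f c\<bar> < k"
    if "c \<in> S" "r \<le> c" "c \<le> q" "0 < k" for c k
  proof -
    have "c \<in> S \<inter> {r..q}" using that by simp
    with cont \<open>0 < k\<close> obtain d where "d > 0" and
      "\<forall>\<tau>\<in>S \<inter> {r..q}. dist \<tau> c < d \<longrightarrow> dist (f \<tau>) (f c) < k"
      unfolding continuous_on_iff by blast
    then show ?thesis unfolding dist_real_def by (intro exI[of _ d]) simp
  qed
  have "\<bar>f q - f r\<bar> \<le> B q"
  proof (rule time_scale_induct[where P = "\<lambda>\<tau>. \<bar>f \<tau> - f r\<bar> \<le> B \<tau>"])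
    show "\<bar>f r - f r\<bar> \<le> B r" by (simp add: B_def)
  next
    fix c assume c: "c \<in> S" "r \<le> c" "c < q" and Bc: "\<bar>f c - f r\<bar> \<le> B c" and lt: "c < fjump S c"
    have "c \<notin> F" using dense[of c] lt by auto
    with deriv[OF c] obtain D where D: "has_delta_derivative S f D c" "\<bar>D\<bar> \<le> M" by blast
    then have "\<bar>f (fjump S c) - f c\<bar> = \<bar>D\<bar> * (fjump S c - c)"
      unfolding has_delta_derivative_scattered[OF c(1) lt] using lt by (simp add: abs_mult)
    also have "\<dots> \<le> (M + e) * (fjump S c - c)"
      by (rule mult_right_mono) (use D(2) e lt in simp_all)
    finally show "\<bar>f (fjump S c) - f r\<bar> \<le> B (fjump S c)"
      by (rule step[OF Bc less_imp_le[OF lt]])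
  next
    fix c assume c: "c \<in> S" "r \<le> c" "c < q" and Bc: "\<bar>f c - f r\<bar> \<le> B c" and rd: "fjump S c = c"
    show "\<exists>d>0. \<forall>\<tau>\<in>S. c < \<tau> \<and> \<tau> < c + d \<and> \<tau> \<le> q \<longrightarrow> \<bar>f \<tau> - f r\<bar> \<le> B \<tau>"
    proof (cases "c \<in> F")
      case True
      from close[OF c(1,2) _ e] c(3) obtain d where "d > 0" and
        d: "\<forall>\<tau>\<in>S. r \<le> \<tau> \<and> \<tau> \<le> q \<and> \<bar>\<tau> - c\<bar> < d \<longrightarrow> \<bar>f \<tau> - f c\<bar> < e" by auto
      have "\<bar>f \<tau> - f r\<bar> \<le> B \<tau>" if "\<tau> \<in> S" "c < \<tau>" "\<tau> < c + d" "\<tau> \<le> q" for \<tau>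
      proof -
        have "\<bar>\<tau> - c\<bar> < d" using that by linarith
        then have "\<bar>f \<tau> - f c\<bar> < e" using d that(1,2,4) c(2) by simp
        then show ?thesis using Bc B_jump[OF that(2) True c(2)] by arith
      qed
      with \<open>d > 0\<close> show ?thesis by blast
    next
      case False
      with deriv[OF c] obtain D where D: "has_delta_derivative S f D c" "\<bar>D\<bar> \<le> M" by blast
      then obtain d where "d > 0" and
        d: "\<forall>\<tau>\<in>S. \<bar>\<tau> - c\<bar> < d \<longrightarrow> \<bar>f c - f \<tau> - D * (c - \<tau>)\<bar> \<le> e * \<bar>c - \<tau>\<bar>"
        using e unfolding has_delta_derivative_def rd by blast
      have "\<bar>f \<tau> - f r\<bar> \<le> B \<tau>" if "\<tau> \<in> S" "c < \<tau>" "\<tau> < c + d" for \<tau>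
      proof (rule step[OF Bc less_imp_le[OF that(2)]])
        have "\<bar>f \<tau> - f c\<bar> \<le> \<bar>D * (c - \<tau>)\<bar> + \<bar>f c - f \<tau> - D * (c - \<tau>)\<bar>" by arith
        also have "\<dots> \<le> M * (\<tau> - c) + e * (\<tau> - c)"
        proof (rule add_mono)
          have abs: "\<bar>\<tau> - c\<bar> < d" "\<bar>c - \<tau>\<bar> = \<tau> - c" using that by linarith+
          show "\<bar>D * (c - \<tau>)\<bar> \<le> M * (\<tau> - c)"
            unfolding abs_mult abs(2) by (rule mult_right_mono[OF D(2)]) (use that(2) in simp)
          show "\<bar>f c - f \<tau> - D * (c - \<tau>)\<bar> \<le> e * (\<tau> - c)"
            using d[rule_format, OF that(1) abs(1)] unfolding abs(2) .
        qed
        also have "\<dots> = (M + e) * (\<tau> - c)" by (rule distrib_right[symmetric])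
        finally show "\<bar>f \<tau> - f c\<bar> \<le> (M + e) * (\<tau> - c)" .
      qed
      with \<open>d > 0\<close> show ?thesis by blast
    qed
  next
    fix c assume c: "c \<in> S" "r < c" "c \<le> q"
      and near: "\<And>d. 0 < d \<Longrightarrow> \<exists>\<tau>\<in>S. r \<le> \<tau> \<and> \<tau> < c \<and> c - d < \<tau> \<and> \<bar>f \<tau> - f r\<bar> \<le> B \<tau>"
    show "\<bar>f c - f r\<bar> \<le> B c"
    proof (rule field_le_epsilon)
      fix k :: real assume "0 < k"
      from close[OF c(1) less_imp_le[OF c(2)] c(3) this] obtain d where "d > 0" and
        d: "\<forall>\<tau>\<in>S. r \<le> \<tau> \<and> \<tau> \<le> q \<and> \<bar>\<tau> - c\<bar> < d \<longrightarrow> \<bar>f \<tau> - f c\<bar> < k" by blast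
      from near[OF \<open>d > 0\<close>] obtain \<tau> where
        \<tau>: "\<tau> \<in> S" "r \<le> \<tau>" "\<tau> < c" "c - d < \<tau>" "\<bar>f \<tau> - f r\<bar> \<le> B \<tau>" by blast
      have "\<bar>\<tau> - c\<bar> < d" "\<tau> \<le> q" using \<tau>(3,4) c(3) by linarith+
      then have "\<bar>f \<tau> - f c\<bar> < k" using d \<tau>(1,2) by blast
      moreover have "B \<tau> \<le> B c"
        using B_mono[OF less_imp_le[OF \<tau>(3)]] mult_nonneg_nonneg[OF Me, of "c - \<tau>"] \<tau>(3)
        by linarith
      ultimately show "\<bar>f c - f r\<bar> \<le> B c + k" using \<tau>(5) by arith
    qed
  qed (rule S r q \<open>r \<le> q\<close>)+
  then show ?thesis unfolding B_def .
qed

lemma delta_mean_value_inequality: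
  fixes f :: "real \<Rightarrow> real"
  assumes S: "closed S" and r: "r \<in> S" and q: "q \<in> S" and "r \<le> q" and "finite F"
    and cont: "continuous_on (S \<inter> {r..q}) f"
    and dense: "\<And>t. t \<in> F \<Longrightarrow> fjump S t = t"
    and deriv: "\<And>t. t \<in> S \<Longrightarrow> r \<le> t \<Longrightarrow> t < q \<Longrightarrow> t \<notin> F \<Longrightarrow>
      \<exists>D. has_delta_derivative S f D t \<and> \<bar>D\<bar> \<le> M"
    and "0 \<le> M"
  shows "\<bar>f q - f r\<bar> \<le> M * (q - r)"
proof (rule field_le_epsilon)
  fix k :: real assume "0 < k"
  define K where "K = q - r + card (F \<inter> {r..<q}) + 1"
  have "K > 0" using \<open>r \<le> q\<close> by (simp add: K_def)
  have "\<bar>f q - f r\<bar> \<le> (M + k / K) * (q - r) + k / K * card (F \<inter> {r..<q})"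
    using \<open>K > 0\<close> \<open>0 < k\<close>
    by (intro delta_mean_value_inequality_margin[OF S] r q \<open>r \<le> q\<close> \<open>finite F\<close> cont dense deriv \<open>0 \<le> M\<close>
        divide_pos_pos)
  also have "\<dots> = M * (q - r) + k / K * (q - r + card (F \<inter> {r..<q}))"
    by (simp only: distrib_left distrib_right add.assoc)
  also have "k / K * (q - r + card (F \<inter> {r..<q})) \<le> k / K * K"
    using \<open>K > 0\<close> \<open>0 < k\<close> by (intro mult_left_mono) (simp_all add: K_def)
  also have "\<dots> = k" using \<open>K > 0\<close> by simp
  finally show "\<bar>f q - f r\<bar> \<le> M * (q - r) + k" by simp
qed

lemma delta_derivative_zero_imp_constant_on:
  fixes f :: "real \<Rightarrow> real"
  assumes "closed S" "a \<in> S" "S \<subseteq> {a..b}" "finite F" "continuous_on S f"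
    and "\<And>t. t \<in> F \<Longrightarrow> fjump S t = t"
    and "\<And>t. t \<in> S \<Longrightarrow> t < b \<Longrightarrow> t \<notin> F \<Longrightarrow> has_delta_derivative S f 0 t"
  shows "f constant_on S"
  unfolding constant_on_def
proof (intro exI ballI)
  fix t assume t: "t \<in> S"
  have "\<bar>f t - f a\<bar> \<le> 0 * (t - a)"
  proof (rule delta_mean_value_inequality[where F = F and S = S])
    show "continuous_on (S \<inter> {a..t}) f" using assms(5) by (rule continuous_on_subset) auto
    show "\<exists>D. has_delta_derivative S f D s \<and> \<bar>D\<bar> \<le> 0" if "s \<in> S" "s < t" "s \<notin> F" for s
    proof -
      have "s < b" using that(2) t assms(3) by auto
      then show ?thesis using assms(7)[OF that(1) _ that(3)] by auto
    qed
    show "a \<le> t" using assms(3) t by auto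
  qed (use assms(1,2,4,6) t in simp_all)
  then show "f t = f a" by simp
qed

section \<open>Interchanging the parameter derivative and the delta derivative\<close>

text \<open>If the parameter derivative of the delta derivative exists and is jointly continuous, it is
  the delta derivative of the parameter derivative. At a right-scattered point both derivatives
  are read off from the same difference quotient, and continuity of the parameter derivative in
  \<open>t\<close> has to be assumed. At a right-dense point, joint continuity and the
  mean value inequality bound the increment of \<open>g s - g s\<^sub>0\<close> near \<open>t\<close>, uniformly in \<open>s\<close>
  after division by \<open>s - s\<^sub>0\<close>, and \<open>s\<close> tends to \<open>s\<^sub>0\<close> from the right.\<close>

lemma has_delta_derivative_partial_deriv:
  fixes g g_t g_ts :: "real \<Rightarrow> real \<Rightarrow> real" and g_s :: "real \<Rightarrow> real"
  assumes S: "closed S" and t: "t \<in> S" "t < b" and s\<^sub>0: "s\<^sub>0 \<in> {l<..<m}"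
    and g_s: "\<And>\<tau>. \<tau> \<in> S \<Longrightarrow> ((\<lambda>s. g s \<tau>) has_real_derivative g_s \<tau>) (at s\<^sub>0)"
    and cont_s: "continuous (at t within S) g_s"
    and g_t: "\<And>s \<tau>. s \<in> {l<..<m} \<Longrightarrow> \<tau> \<in> S \<Longrightarrow> \<tau> < b \<Longrightarrow>
      has_delta_derivative S (g s) (g_t s \<tau>) \<tau>"
    and g_ts: "\<And>s \<tau>. s \<in> {l<..<m} \<Longrightarrow> \<tau> \<in> S \<Longrightarrow> \<tau> < b \<Longrightarrow>
      ((\<lambda>s. g_t s \<tau>) has_real_derivative g_ts s \<tau>) (at s)"
    and cont_ts: "continuous_on ({l<..<m} \<times> (S \<inter> {..<b})) (\<lambda>(s, \<tau>). g_ts s \<tau>)"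
  shows "has_delta_derivative S g_s (g_ts s\<^sub>0 t) t"
proof (cases "fjump S t = t")
  case False
  then have lt: "t < fjump S t" using fjump_ge[of t S] by simp
  let ?\<mu> = "fjump S t - t"
  have "((\<lambda>s. g_t s t * ?\<mu>) has_real_derivative g_ts s\<^sub>0 t * ?\<mu>) (at s\<^sub>0)"
    by (intro DERIV_cmult_right g_ts s\<^sub>0 t)
  moreover have "g s (fjump S t) - g s t = g_t s t * ?\<mu>" if "s \<in> {l<..<m}" for s
    using g_t[OF that t] by (simp add: has_delta_derivative_scattered[OF t(1) lt])
  ultimately have "((\<lambda>s. g s (fjump S t) - g s t) has_real_derivative g_ts s\<^sub>0 t * ?\<mu>) (at s\<^sub>0)"
    using s\<^sub>0 by (auto elim!: has_field_derivative_transform_within_open[of _ _ _ "{l<..<m}"])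
  moreover have "((\<lambda>s. g s (fjump S t) - g s t) has_real_derivative g_s (fjump S t) - g_s t) (at s\<^sub>0)"
    by (intro DERIV_diff g_s fjump_mem S t)
  ultimately show ?thesis
    using cont_s by (auto simp: has_delta_derivative_scattered[OF t(1) lt] dest: DERIV_unique)
next
  case True
  let ?c = "g_ts s\<^sub>0 t"
  show ?thesis
    unfolding has_delta_derivative_def True
  proof (intro allI impI)
    fix e :: real assume e: "0 < e"
    from cont_ts s\<^sub>0 t e obtain d\<^sub>0 where "d\<^sub>0 > 0" and
      d\<^sub>0: "\<And>z. z \<in> {l<..<m} \<times> (S \<inter> {..<b}) \<Longrightarrow> dist z (s\<^sub>0, t) < d\<^sub>0 \<Longrightarrow>
        dist (case z of (s, \<tau>) \<Rightarrow> g_ts s \<tau>) ?c < e"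
      unfolding continuous_on_iff by (metis (no_types, lifting) IntI SigmaI case_prod_conv lessThan_iff)
    define d where "d = min (d\<^sub>0 / 2) (min (b - t) (m - s\<^sub>0))"
    have d: "0 < d" "d \<le> b - t" "s\<^sub>0 + d \<le> m"
      using \<open>d\<^sub>0 > 0\<close> t(2) s\<^sub>0 unfolding d_def by (simp_all add: min_def)
    have near: "\<bar>g_ts s \<tau> - ?c\<bar> \<le> e"
      if "\<tau> \<in> S" "\<bar>\<tau> - t\<bar> < d" "s\<^sub>0 \<le> s" "s < s\<^sub>0 + d" for s \<tau>
    proof -
      have "dist (s, \<tau>) (s\<^sub>0, t) \<le> \<bar>s - s\<^sub>0\<bar> + \<bar>\<tau> - t\<bar>"
        unfolding dist_prod_def using sqrt_sum_squares_le_sum_abs[of "dist s s\<^sub>0" "dist \<tau> t"]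
        by (simp add: dist_real_def)
      also have "\<dots> < d\<^sub>0"
      proof -
        have "d \<le> d\<^sub>0 / 2" unfolding d_def by (rule min.cobounded1)
        then show ?thesis using that by linarith
      qed
      finally have "dist (s, \<tau>) (s\<^sub>0, t) < d\<^sub>0" .
      moreover have "\<tau> < b" "s < m" using that d by linarith+
      ultimately show ?thesis
        using d\<^sub>0[of "(s, \<tau>)"] that(1,3) s\<^sub>0 by (auto simp: dist_real_def)
    qed
    have quot: "\<bar>(g s q - g s\<^sub>0 q) - (g s r - g s\<^sub>0 r) - (s - s\<^sub>0) * ?c * (q - r)\<bar>
        \<le> e * (s - s\<^sub>0) * (q - r)"
      if s: "s\<^sub>0 < s" "s < s\<^sub>0 + d" and rq: "r \<in> S" "q \<in> S" "r \<le> q" "t - d < r" "q < t + d"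
      for s r q
    proof -
      \<comment> \<open>The coefficient of \<open>\<tau>\<close> makes the delta derivative of \<open>f\<close> equal to
        \<open>(s - s\<^sub>0) * (g_ts z \<tau> - ?c)\<close> for some intermediate \<open>z\<close>.\<close>
      define f where "f \<tau> = g s \<tau> + (-1) * g s\<^sub>0 \<tau> + (- (s - s\<^sub>0) * ?c) * \<tau>" for \<tau>
      have sP: "s \<in> {l<..<m}" using s s\<^sub>0 d by auto
      have der: "has_delta_derivative S f (g_t s \<tau> + (-1) * g_t s\<^sub>0 \<tau> + (- (s - s\<^sub>0) * ?c) * 1) \<tau>"
        if "\<tau> \<in> S" "\<tau> < b" for \<tau>
        unfolding f_def
        by (intro has_delta_derivative_add has_delta_derivative_cmult has_delta_derivative_ident
            g_t that sP s\<^sub>0)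
      have "\<bar>f q - f r\<bar> \<le> (e * (s - s\<^sub>0)) * (q - r)"
      proof (rule delta_mean_value_inequality[where F = "{}" and S = S])
        show "continuous_on (S \<inter> {r..q}) f"
          unfolding continuous_on_eq_continuous_within
        proof
          fix \<tau> assume \<tau>: "\<tau> \<in> S \<inter> {r..q}"
          then have "\<tau> < b" using rq d by auto
          then have "continuous (at \<tau> within S) f"
            using der \<tau> has_delta_derivative_continuous by blast
          then show "continuous (at \<tau> within S \<inter> {r..q}) f"
            by (rule continuous_within_subset) auto
        qed
        fix \<tau> assume \<tau>: "\<tau> \<in> S" "r \<le> \<tau>" "\<tau> < q"
        then have "\<tau> < b" using rq d by auto
        obtain z where z: "s\<^sub>0 < z" "z < s" "g_t s \<tau> - g_t s\<^sub>0 \<tau> = (s - s\<^sub>0) * g_ts z \<tau>"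
          using MVT2[of s\<^sub>0 s "\<lambda>s. g_t s \<tau>" "\<lambda>s. g_ts s \<tau>"] g_ts[OF _ \<tau>(1) \<open>\<tau> < b\<close>] sP s\<^sub>0 s
          by auto
        have "g_t s \<tau> + (-1) * g_t s\<^sub>0 \<tau> + (- (s - s\<^sub>0) * ?c) * 1 = (s - s\<^sub>0) * (g_ts z \<tau> - ?c)"
          using z(3) by (simp add: algebra_simps)
        moreover have "\<bar>(s - s\<^sub>0) * (g_ts z \<tau> - ?c)\<bar> \<le> e * (s - s\<^sub>0)"
        proof -
          have "\<bar>\<tau> - t\<bar> < d" "s\<^sub>0 \<le> z" "z < s\<^sub>0 + d" using \<tau> rq(4,5) z(1,2) s by linarith+
          from mult_right_mono[OF near[OF \<tau>(1) this], of "s - s\<^sub>0"] show ?thesis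
            using s(1) by (simp add: abs_mult mult.commute)
        qed
        ultimately show "\<exists>D. has_delta_derivative S f D \<tau> \<and> \<bar>D\<bar> \<le> e * (s - s\<^sub>0)"
          using der[OF \<tau>(1) \<open>\<tau> < b\<close>] by metis
      qed (use S rq e s in auto)
      moreover have "f q - f r = (g s q - g s\<^sub>0 q) - (g s r - g s\<^sub>0 r) - (s - s\<^sub>0) * ?c * (q - r)"
        by (simp add: f_def algebra_simps)
      ultimately show ?thesis by simp
    qed
    have lim: "\<bar>g_s q - g_s r - ?c * (q - r)\<bar> \<le> e * (q - r)"
      if rq: "r \<in> S" "q \<in> S" "r \<le> q" "t - d < r" "q < t + d" for r q
    proof (rule tendsto_upperbound)
      have right: "((\<lambda>s. (g s \<tau> - g s\<^sub>0 \<tau>) / (s - s\<^sub>0)) \<longlongrightarrow> g_s \<tau>) (at_right s\<^sub>0)" if "\<tau> \<in> S" for \<tau>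
        using g_s[OF that] unfolding has_field_derivative_iff
        by (rule filterlim_mono) (auto simp: at_within_le_at)
      show "((\<lambda>s. \<bar>(g s q - g s\<^sub>0 q) / (s - s\<^sub>0) - (g s r - g s\<^sub>0 r) / (s - s\<^sub>0) - ?c * (q - r)\<bar>)
          \<longlongrightarrow> \<bar>g_s q - g_s r - ?c * (q - r)\<bar>) (at_right s\<^sub>0)"
        by (intro tendsto_intros right rq)
      have "\<bar>(g s q - g s\<^sub>0 q) / (s - s\<^sub>0) - (g s r - g s\<^sub>0 r) / (s - s\<^sub>0) - ?c * (q - r)\<bar> \<le> e * (q - r)"
        if s: "s \<in> {s\<^sub>0<..<s\<^sub>0 + d}" for s
      proof -
        have pos: "0 < s - s\<^sub>0" using s by simp
        have "(g s q - g s\<^sub>0 q) / (s - s\<^sub>0) - (g s r - g s\<^sub>0 r) / (s - s\<^sub>0) - ?c * (q - r)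
          = ((g s q - g s\<^sub>0 q) - (g s r - g s\<^sub>0 r) - (s - s\<^sub>0) * ?c * (q - r)) / (s - s\<^sub>0)"
          using pos by (simp add: diff_divide_distrib)
        also have "\<bar>\<dots>\<bar> \<le> e * (s - s\<^sub>0) * (q - r) / (s - s\<^sub>0)"
          unfolding abs_divide abs_of_pos[OF pos]
          using quot[OF _ _ rq, of s] s pos by (intro divide_right_mono) auto
        also have "\<dots> = e * (q - r)" using pos by simp
        finally show ?thesis .
      qed
      then show "\<forall>\<^sub>F s in at_right s\<^sub>0.
          \<bar>(g s q - g s\<^sub>0 q) / (s - s\<^sub>0) - (g s r - g s\<^sub>0 r) / (s - s\<^sub>0) - ?c * (q - r)\<bar> \<le> e * (q - r)"
        using d(1) by (intro eventually_at_rightI[of s\<^sub>0 "s\<^sub>0 + d"]) auto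
    qed auto
    have "\<bar>g_s t - g_s \<tau> - ?c * (t - \<tau>)\<bar> \<le> e * \<bar>t - \<tau>\<bar>" if "\<tau> \<in> S" "\<bar>\<tau> - t\<bar> < d" for \<tau>
    proof (cases "\<tau> \<le> t")
      case True
      moreover have "t - d < \<tau>" "t < t + d" using that(2) d(1) by linarith+
      ultimately show ?thesis using lim[OF that(1) t(1)] by simp
    next
      case False
      have "g_s t - g_s \<tau> - ?c * (t - \<tau>) = - (g_s \<tau> - g_s t - ?c * (\<tau> - t))"
        by (simp add: algebra_simps)
      moreover have "t \<le> \<tau>" "t - d < t" "\<tau> < t + d" "\<bar>t - \<tau>\<bar> = \<tau> - t"
        using that(2) d(1) False by linarith+
      ultimately show ?thesis using lim[OF t(1) that(1)] by (simp only: abs_minus_cancel)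
    qed
    then show "\<exists>d>0. \<forall>s\<in>S. \<bar>s - t\<bar> < d \<longrightarrow> \<bar>g_s t - g_s s - ?c * (t - s)\<bar> \<le> e * \<bar>t - s\<bar>"
      using d(1) by blast
  qed
qed

section \<open>Conservation of the Noether quantity\<close>

text \<open>The chain rule for a function of two real variables, in terms of its partial derivatives.
  Along each coordinate line it also shows that these are the components of the total
  derivative.\<close>

lemma has_real_derivative_compose2:
  fixes f :: "real \<Rightarrow> real \<Rightarrow> real"
  assumes f: "(\<lambda>(y, v). f y v) differentiable (at (y s, v s))"
    and y: "(y has_real_derivative y') (at s)" and v: "(v has_real_derivative v') (at s)"
  shows "((\<lambda>s. f (y s) (v s)) has_real_derivative
    deriv (\<lambda>z. f z (v s)) (y s) * y' + deriv (\<lambda>w. f (y s) w) (v s) * v') (at s)"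
proof -
  obtain D where D: "((\<lambda>(y, v). f y v) has_derivative D) (at (y s, v s))"
    using f unfolding differentiable_def by blast
  have lin: "linear D" using D by (intro bounded_linear.linear has_derivative_bounded_linear)
  have Dpair: "D (\<alpha> * k, \<beta> * k) = D (\<alpha>, \<beta>) * k" for \<alpha> \<beta> k
    using linear_scale[OF lin, of k "(\<alpha>, \<beta>)"] by (simp add: mult.commute)
  have comp: "((\<lambda>s. f (Y s) (V s)) has_real_derivative D (Y', V')) (at r)"
    if "(Y has_real_derivative Y') (at r)" "(V has_real_derivative V') (at r)"
       "Y r = y s" "V r = v s" for Y V Y' V' r
  proof -
    have "((\<lambda>s. (Y s, V s)) has_derivative (\<lambda>k. (Y' * k, V' * k))) (at r)"
      using that(1,2) unfolding has_field_derivative_def by (rule has_derivative_Pair)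
    from has_derivative_compose[OF this, of "\<lambda>(y, v). f y v" D] show ?thesis
      using D that(3,4) by (simp add: has_field_derivative_def Dpair)
  qed
  have "deriv (\<lambda>z. f z (v s)) (y s) = D (1, 0)"
    by (intro DERIV_imp_deriv comp) auto
  moreover have "deriv (\<lambda>w. f (y s) w) (v s) = D (0, 1)"
    by (intro DERIV_imp_deriv comp) auto
  moreover have "D (y', v') = D (1, 0) * y' + D (0, 1) * v'"
    using linear_add[OF lin, of "(1 * y', 0 * y')" "(0 * v', 1 * v')"] unfolding Dpair by simp
  ultimately show ?thesis using comp[OF y v] by simp
qed

lemma mem_ts_ival_bjump:
  assumes "t \<in> ts_ival T a b" "t < b"
  shows "t \<in> ts_ival T a (bjump T b)"
proof -
  have "bdd_above {s \<in> T. s < b}" by (rule bdd_aboveI[of _ b]) auto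
  then have "t \<le> bjump T b"
    using assms unfolding bjump_def ts_ival_def by (auto intro!: cSup_upper)
  with assms show ?thesis by (auto simp: ts_ival_def)
qed

text \<open>The part of \<open>C2_partial\<close> that matters here, with the parameter derivative at \<open>0\<close> written as
  \<open>deriv\<close>: it is continuous in \<open>t\<close>, and its delta derivative is the parameter derivative of the
  delta derivative.\<close>

lemma C2_partial_mixed:
  assumes cl: "closed T" and "b \<in> T" and "0 < \<epsilon>" and C2: "C2_partial T a b \<epsilon> g"
  obtains g_t g_ts where
    "continuous_on (ts_ival T a b) (\<lambda>t. deriv (\<lambda>s. g s t) 0)"
    "\<forall>s\<in>{-\<epsilon><..<\<epsilon>}. \<forall>t\<in>ts_ival T a b. t < b \<longrightarrow>
       delta_deriv (ts_ival T a b) (g s) t = g_t s t"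
    "\<forall>t\<in>ts_ival T a b. ((\<lambda>s. g s t) has_real_derivative deriv (\<lambda>s. g s t) 0) (at 0)"
    "\<forall>t\<in>ts_ival T a b. t < b \<longrightarrow> ((\<lambda>s. g_t s t) has_real_derivative g_ts t) (at 0)"
    "\<forall>t\<in>ts_ival T a b. t < b \<longrightarrow>
       has_delta_derivative (ts_ival T a b) (\<lambda>t. deriv (\<lambda>s. g s t) 0) (g_ts t) t"
proof -
  let ?P = "{-\<epsilon><..<\<epsilon>}" and ?I = "ts_ival T a b"
  note I1 = mem_ts_ival_bjump[of _ T a b]
  from C2[unfolded C2_partial_def Let_def] obtain g_s g_t g_ts where
    s: "\<forall>s\<in>?P. \<forall>t\<in>?I. ((\<lambda>r. g r t) has_real_derivative g_s s t) (at s)"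
    and gt: "\<forall>s\<in>?P. \<forall>t\<in>ts_ival T a (bjump T b). has_delta_derivative ?I (g s) (g_t s t) t"
    and ts: "\<forall>s\<in>?P. \<forall>t\<in>ts_ival T a (bjump T b). ((\<lambda>r. g_t r t) has_real_derivative g_ts s t) (at s)"
    and cs: "continuous_on (?P \<times> ?I) (\<lambda>(s, t). g_s s t)"
    and cts: "continuous_on (?P \<times> ts_ival T a (bjump T b)) (\<lambda>(s, t). g_ts s t)"
    by (atomize_elim, elim exE conjE, intro exI conjI)
  have 0: "0 \<in> ?P" using \<open>0 < \<epsilon>\<close> by simp
  have dg: "deriv (\<lambda>s. g s t) 0 = g_s 0 t" if "t \<in> ?I" for t
    using s 0 that by (intro DERIV_imp_deriv) auto
  have s0: "((\<lambda>s. g s t) has_real_derivative deriv (\<lambda>s. g s t) 0) (at 0)" if "t \<in> ?I" for t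
    using s 0 that dg by auto
  have cont: "continuous_on ?I (\<lambda>t. deriv (\<lambda>s. g s t) 0)"
  proof -
    have "continuous_on ?I ((\<lambda>(s, t). g_s s t) \<circ> (\<lambda>t. (0, t)))"
      using 0 by (intro continuous_on_compose continuous_intros continuous_on_subset[OF cs]) auto
    then show ?thesis using dg by (simp add: o_def cong: continuous_on_cong)
  qed
  have clI: "closed ?I" unfolding ts_ival_def using cl by auto
  have bI: "b \<in> ?I" if "t \<in> ?I" for t using that \<open>b \<in> T\<close> by (auto simp: ts_ival_def)
  show ?thesis
  proof (rule that[of g_t "g_ts 0"])
    show "\<forall>s\<in>?P. \<forall>t\<in>?I. t < b \<longrightarrow> delta_deriv ?I (g s) t = g_t s t"
      using gt I1 bI delta_deriv_eq by blast
    show "\<forall>t\<in>?I. t < b \<longrightarrow> ((\<lambda>s. g_t s t) has_real_derivative g_ts 0 t) (at 0)"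
      using ts I1 0 by blast
    have "has_delta_derivative ?I (\<lambda>t. deriv (\<lambda>s. g s t) 0) (g_ts 0 t) t"
      if t: "t \<in> ?I" "t < b" for t
    proof (rule has_delta_derivative_partial_deriv[where l = "-\<epsilon>" and m = \<epsilon> and b = b
          and g = g and g_t = g_t and g_ts = g_ts])
      show "continuous (at t within ?I) (\<lambda>t. deriv (\<lambda>s. g s t) 0)"
        using cont t by (simp add: continuous_on_eq_continuous_within)
      show "continuous_on (?P \<times> (?I \<inter> {..<b})) (\<lambda>(s, t). g_ts s t)"
        using I1 by (intro continuous_on_subset[OF cts]) auto
      show "has_delta_derivative ?I (g s) (g_t s \<tau>) \<tau>" if "s \<in> ?P" "\<tau> \<in> ?I" "\<tau> < b" for s \<tau>
        using gt that(1) I1[OF that(2,3)] by blast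
      show "((\<lambda>s. g_t s \<tau>) has_real_derivative g_ts s \<tau>) (at s)"
        if "s \<in> ?P" "\<tau> \<in> ?I" "\<tau> < b" for s \<tau>
        using ts that(1) I1[OF that(2,3)] by blast
    qed (rule clI t 0 s0, assumption?)+
    then show "\<forall>t\<in>?I. t < b \<longrightarrow>
        has_delta_derivative ?I (\<lambda>t. deriv (\<lambda>s. g s t) 0) (g_ts 0 t) t" by blast
  qed (use cont s0 in auto)
qed

text \<open>The first variation at \<open>s = 0\<close> of a family \<open>g s t x u\<close> along the pair \<open>(x, u)\<close>.\<close>

abbreviation variation ::
  "(real \<Rightarrow> real \<Rightarrow> real \<Rightarrow> real \<Rightarrow> real) \<Rightarrow> (real \<Rightarrow> real) \<Rightarrow> (real \<Rightarrow> real) \<Rightarrow> real \<Rightarrow> real"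
where
  "variation g x u t \<equiv> deriv (\<lambda>s. g s t (x t) (u t)) 0"

text \<open>The linearised equations: \<open>w\<close> is the derivative at \<open>s = 0\<close> of the transformed control. They
  are the invariance identities differentiated in \<open>s\<close>, with the two derivatives interchanged.\<close>

lemma linearised_invariance:
  assumes T: "time_scale T" and "b \<in> T" and "0 < \<epsilon>" and reg: "regular_problem T a b L \<phi>"
    and trans: "transformation_family T a b \<phi> \<epsilon> h" and inv: "invariant_up_to T a b L \<phi> \<epsilon> h \<Phi>"
    and adm: "admissible T a b \<phi> x u"
  obtains w where
    "continuous_on (ts_ival T a b) (variation h x u)"
    "continuous_on (ts_ival T a b) (variation \<Phi> x u)"
    "\<forall>t\<in>ts_ival T a b. t < b \<longrightarrow> has_delta_derivative (ts_ival T a b) (variation h x u)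
       (pd_x \<phi> t (x t) (u t) * variation h x u t + pd_u \<phi> t (x t) (u t) * w t) t"
    "\<forall>t\<in>ts_ival T a b. t < b \<longrightarrow> has_delta_derivative (ts_ival T a b) (variation \<Phi> x u)
       (pd_x L t (x t) (u t) * variation h x u t + pd_u L t (x t) (u t) * w t) t"
proof -
  let ?I = "ts_ival T a b" and ?I1 = "ts_ival T a (bjump T b)" and ?P = "{-\<epsilon><..<\<epsilon>}"
  let ?\<xi> = "variation h x u" and ?\<eta> = "variation \<Phi> x u"
  note I1 = mem_ts_ival_bjump[of _ T a b]
  have cl: "closed T" using T by (simp add: time_scale_def)
  have "0 \<in> ?P" using \<open>0 < \<epsilon>\<close> by simp
  have diffL: "(\<lambda>(y, v). L t y v) differentiable (at z)"
    and diff\<phi>: "(\<lambda>(y, v). \<phi> t y v) differentiable (at z)" if "t \<in> ?I" "t < b" for t z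
    using reg I1[OF that] unfolding regular_problem_def Let_def by blast+
  have h0: "h 0 t y v = y" if "t \<in> ?I" for t y v
    using trans that by (auto simp: transformation_family_def)
  from trans adm have Ch: "C2_partial T a b \<epsilon> (\<lambda>s t. h s t (x t) (u t))"
    by (auto simp: transformation_family_def)
  from inv adm have C\<Phi>: "C2_partial T a b \<epsilon> (\<lambda>s t. \<Phi> s t (x t) (u t))"
    by (auto simp: invariant_up_to_def Let_def)
  from inv[unfolded invariant_up_to_def Let_def, rule_format, OF adm]
  obtain us where us0: "\<forall>t\<in>?I1. us 0 t = u t"
    and us: "\<forall>s\<in>?P. C_prd ?I1 (us s) \<and>
      (\<forall>t\<in>?I1. (\<lambda>r. us r t) differentiable (at s)) \<and>
      C_prd ?I1 (\<lambda>t. deriv (\<lambda>r. us r t) s) \<and>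
      (\<forall>t\<in>?I1.
        L t (x t) (u t) + delta_deriv ?I (\<lambda>\<tau>. \<Phi> s \<tau> (x \<tau>) (u \<tau>)) t = L t (h s t (x t) (u t)) (us s t) \<and>
        delta_deriv ?I (\<lambda>\<tau>. h s \<tau> (x \<tau>) (u \<tau>)) t = \<phi> t (h s t (x t) (u t)) (us s t))"
    by (elim conjE exE)
  have usd: "(\<lambda>r. us r t) differentiable (at s)"
    and invL: "L t (x t) (u t) + delta_deriv ?I (\<lambda>\<tau>. \<Phi> s \<tau> (x \<tau>) (u \<tau>)) t
      = L t (h s t (x t) (u t)) (us s t)"
    and inv\<phi>: "delta_deriv ?I (\<lambda>\<tau>. h s \<tau> (x \<tau>) (u \<tau>)) t = \<phi> t (h s t (x t) (u t)) (us s t)"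
    if "s \<in> ?P" "t \<in> ?I1" for s t
    using us[rule_format, OF that(1)] that(2) by simp_all
  obtain h_t h_ts where h:
    "continuous_on ?I ?\<xi>"
    "\<forall>s\<in>?P. \<forall>t\<in>?I. t < b \<longrightarrow> delta_deriv ?I (\<lambda>t. h s t (x t) (u t)) t = h_t s t"
    "\<forall>t\<in>?I. ((\<lambda>s. h s t (x t) (u t)) has_real_derivative ?\<xi> t) (at 0)"
    "\<forall>t\<in>?I. t < b \<longrightarrow> ((\<lambda>s. h_t s t) has_real_derivative h_ts t) (at 0)"
    "\<forall>t\<in>?I. t < b \<longrightarrow> has_delta_derivative ?I ?\<xi> (h_ts t) t"
    by (rule C2_partial_mixed[OF cl \<open>b \<in> T\<close> \<open>0 < \<epsilon>\<close> Ch])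
  obtain \<Phi>_t \<Phi>_ts where \<Phi>:
    "continuous_on ?I ?\<eta>"
    "\<forall>s\<in>?P. \<forall>t\<in>?I. t < b \<longrightarrow> delta_deriv ?I (\<lambda>t. \<Phi> s t (x t) (u t)) t = \<Phi>_t s t"
    "\<forall>t\<in>?I. ((\<lambda>s. \<Phi> s t (x t) (u t)) has_real_derivative ?\<eta> t) (at 0)"
    "\<forall>t\<in>?I. t < b \<longrightarrow> ((\<lambda>s. \<Phi>_t s t) has_real_derivative \<Phi>_ts t) (at 0)"
    "\<forall>t\<in>?I. t < b \<longrightarrow> has_delta_derivative ?I ?\<eta> (\<Phi>_ts t) t"
    by (rule C2_partial_mixed[OF cl \<open>b \<in> T\<close> \<open>0 < \<epsilon>\<close> C\<Phi>])
  note h = h[rule_format] and \<Phi> = \<Phi>[rule_format]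
  have linearised:
    "\<Phi>_ts t = pd_x L t (x t) (u t) * ?\<xi> t + pd_u L t (x t) (u t) * deriv (\<lambda>s. us s t) 0"
    "h_ts t = pd_x \<phi> t (x t) (u t) * ?\<xi> t + pd_u \<phi> t (x t) (u t) * deriv (\<lambda>s. us s t) 0"
    if t: "t \<in> ?I" "t < b" for t
  proof -
    have w: "((\<lambda>s. us s t) has_real_derivative deriv (\<lambda>s. us s t) 0) (at 0)"
      using usd[OF \<open>0 \<in> ?P\<close> I1[OF t]]
      by (simp add: DERIV_deriv_iff_real_differentiable)
    have chain: "((\<lambda>s. f t (h s t (x t) (u t)) (us s t)) has_real_derivative
        pd_x f t (x t) (u t) * ?\<xi> t + pd_u f t (x t) (u t) * deriv (\<lambda>s. us s t) 0) (at 0)"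
      if "\<And>z. (\<lambda>(y, v). f t y v) differentiable (at z)" for f
      using has_real_derivative_compose2[OF that h(3)[OF t(1)] w]
      by (simp add: pd_x_def pd_u_def h0[OF t(1)] us0[rule_format, OF I1[OF t]])
    have "((\<lambda>s. L t (x t) (u t) + \<Phi>_t s t) has_real_derivative 0 + \<Phi>_ts t) (at 0)"
      by (intro DERIV_add DERIV_const \<Phi>(4) t)
    then have "((\<lambda>s. L t (h s t (x t) (u t)) (us s t)) has_real_derivative 0 + \<Phi>_ts t) (at 0)"
      by (rule has_field_derivative_transform_within_open[of _ _ _ ?P])
        (use \<open>0 \<in> ?P\<close> invL[OF _ I1[OF t]] \<Phi>(2)[OF _ t] in simp_all)
    from DERIV_unique[OF this chain[of L, OF diffL[OF t]]]
    show "\<Phi>_ts t = pd_x L t (x t) (u t) * ?\<xi> t + pd_u L t (x t) (u t) * deriv (\<lambda>s. us s t) 0"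
      by simp
    from h(4)[OF t]
    have "((\<lambda>s. \<phi> t (h s t (x t) (u t)) (us s t)) has_real_derivative h_ts t) (at 0)"
      by (rule has_field_derivative_transform_within_open[of _ _ _ ?P])
        (use \<open>0 \<in> ?P\<close> inv\<phi>[OF _ I1[OF t]] h(2)[OF _ t] in simp_all)
    from DERIV_unique[OF this chain[of \<phi>, OF diff\<phi>[OF t]]]
    show "h_ts t = pd_x \<phi> t (x t) (u t) * ?\<xi> t + pd_u \<phi> t (x t) (u t) * deriv (\<lambda>s. us s t) 0" .
  qed
  let ?w = "\<lambda>t. deriv (\<lambda>s. us s t) 0"
  have \<xi>: "has_delta_derivative ?I ?\<xi> (pd_x \<phi> t (x t) (u t) * ?\<xi> t + pd_u \<phi> t (x t) (u t) * ?w t) t"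
    and \<eta>: "has_delta_derivative ?I ?\<eta> (pd_x L t (x t) (u t) * ?\<xi> t + pd_u L t (x t) (u t) * ?w t) t"
    if "t \<in> ?I" "t < b" for t
    using h(5)[OF that] \<Phi>(5)[OF that] unfolding linearised[OF that] .
  show ?thesis
    by (rule that[of ?w]) (intro h(1) \<Phi>(1) ballI impI \<xi> \<eta>; assumption)+
qed

text \<open>Continuity of the conserved quantity, and vanishing of its delta derivative. At a
  right-scattered point the continuous function \<open>p\<close> is delta differentiable, so the disjunction
  amounts to delta differentiability of \<open>p\<close>.\<close>

lemma noether_delta_derivative_zero:
  assumes "time_scale T" and "b \<in> T" and "0 < \<epsilon>" and "regular_problem T a b L \<phi>"
    and "transformation_family T a b \<phi> \<epsilon> h" and "invariant_up_to T a b L \<phi> \<epsilon> h \<Phi>"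
    and ext: "extremal T a b L \<phi> x u lam p"
  shows "continuous_on (ts_ival T a b) (\<lambda>t. p t * variation h x u t + lam * variation \<Phi> x u t)"
    and "\<lbrakk>t \<in> ts_ival T a b; t < b;
      delta_differentiable (ts_ival T a b) p t \<or> fjump (ts_ival T a b) t \<noteq> t\<rbrakk> \<Longrightarrow>
      has_delta_derivative (ts_ival T a b)
        (\<lambda>t. p t * variation h x u t + lam * variation \<Phi> x u t) 0 t"
proof -
  let ?I = "ts_ival T a b" and ?\<xi> = "variation h x u" and ?\<eta> = "variation \<Phi> x u"
  have adm: "admissible T a b \<phi> x u" and p: "continuous_on ?I p"
    using ext by (auto simp: extremal_def C1_prd_def)
  obtain w where cont: "continuous_on ?I ?\<xi>" "continuous_on ?I ?\<eta>"
    and \<xi>: "\<forall>t\<in>?I. t < b \<longrightarrow> has_delta_derivative ?I ?\<xi>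
      (pd_x \<phi> t (x t) (u t) * ?\<xi> t + pd_u \<phi> t (x t) (u t) * w t) t"
    and \<eta>: "\<forall>t\<in>?I. t < b \<longrightarrow> has_delta_derivative ?I ?\<eta>
      (pd_x L t (x t) (u t) * ?\<xi> t + pd_u L t (x t) (u t) * w t) t"
    by (rule linearised_invariance[OF assms(1-6) adm])
  show "continuous_on ?I (\<lambda>t. p t * ?\<xi> t + lam * ?\<eta> t)"
    by (intro continuous_intros p cont)
  assume t: "t \<in> ?I" "t < b" and "delta_differentiable ?I p t \<or> fjump ?I t \<noteq> t"
  then have pd: "delta_differentiable ?I p t"
    using p fjump_ge[of t ?I] delta_differentiable_scattered[of t ?I p]
    unfolding continuous_on_eq_continuous_within by auto
  then obtain D where D: "has_delta_derivative ?I p D t" by (auto simp: delta_differentiable_def)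
  have t1: "t \<in> ts_ival T a (bjump T b)" using t by (rule mem_ts_ival_bjump)
  have "b \<in> ?I" using t(1) \<open>b \<in> T\<close> by (simp add: ts_ival_def)
  then have "delta_deriv ?I p t = D" using t D by (intro delta_deriv_eq)
  then have D_eq: "D = - (pd_x \<phi> t (x t) (u t) * p (fjump ?I t) + lam * pd_x L t (x t) (u t))"
    using ext t1 pd unfolding extremal_def by fastforce
  have stationary: "pd_u \<phi> t (x t) (u t) * p (fjump ?I t) + lam * pd_u L t (x t) (u t) = 0"
    using ext t1 unfolding extremal_def by blast
  have "has_delta_derivative ?I (\<lambda>t. p t * ?\<xi> t + lam * ?\<eta> t)
      ((D * ?\<xi> t + p (fjump ?I t) * (pd_x \<phi> t (x t) (u t) * ?\<xi> t + pd_u \<phi> t (x t) (u t) * w t))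
        + lam * (pd_x L t (x t) (u t) * ?\<xi> t + pd_u L t (x t) (u t) * w t)) t"
    using t by (intro has_delta_derivative_add has_delta_derivative_mult has_delta_derivative_cmult
        D \<xi>[rule_format] \<eta>[rule_format])
  also have "(D * ?\<xi> t + p (fjump ?I t) * (pd_x \<phi> t (x t) (u t) * ?\<xi> t + pd_u \<phi> t (x t) (u t) * w t))
        + lam * (pd_x L t (x t) (u t) * ?\<xi> t + pd_u L t (x t) (u t) * w t)
      = w t * (pd_u \<phi> t (x t) (u t) * p (fjump ?I t) + lam * pd_u L t (x t) (u t))"
    unfolding D_eq by (simp add: algebra_simps)
  also have "\<dots> = 0" using stationary by simp
  finally show "has_delta_derivative ?I (\<lambda>t. p t * ?\<xi> t + lam * ?\<eta> t) 0 t" .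
qed

lemma noether_constant_on:
  assumes "time_scale T" and "a \<in> T" and "b \<in> T" and "a < b" and "0 < \<epsilon>"
    and "regular_problem T a b L \<phi>" and "transformation_family T a b \<phi> \<epsilon> h"
    and "invariant_up_to T a b L \<phi> \<epsilon> h \<Phi>" and ext: "extremal T a b L \<phi> x u lam p"
  shows "(\<lambda>t. p t * variation h x u t + lam * variation \<Phi> x u t) constant_on (ts_ival T a b)"
proof -
  let ?I = "ts_ival T a b"
  note noether = noether_delta_derivative_zero[OF assms(1,3,5-9)]
  define F where "F = {t \<in> ?I. t < b \<and> \<not> delta_differentiable ?I p t \<and> fjump ?I t = t}"
  show ?thesis
  proof (rule delta_derivative_zero_imp_constant_on[where F = F and b = b])
    show "closed ?I" using assms(1) by (auto simp: time_scale_def ts_ival_def)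
    show "a \<in> ?I" "?I \<subseteq> {a..b}" using assms(2,4) by (auto simp: ts_ival_def)
    obtain F' where "finite F'"
      "\<forall>t\<in>ts_ival T a (bjump T b) - F'. delta_differentiable ?I p t"
      using ext unfolding extremal_def C1_prd_def by blast
    then show "finite F"
      using mem_ts_ival_bjump[of _ T a b] by (intro finite_subset[of F F']) (auto simp: F_def)
    show "has_delta_derivative ?I (\<lambda>t. p t * variation h x u t + lam * variation \<Phi> x u t) 0 t"
      if "t \<in> ?I" "t < b" "t \<notin> F" for t
      using noether(2)[OF that(1,2)] that by (auto simp: F_def)
  qed (use noether(1) in \<open>simp_all add: F_def\<close>)
qed

theorem theorem3p4:
  fixes T :: "real set" and a b \<epsilon> :: real
    and L \<phi> :: "real \<Rightarrow> real \<Rightarrow> real \<Rightarrow> real"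
    and h \<Phi> :: "real \<Rightarrow> real \<Rightarrow> real \<Rightarrow> real \<Rightarrow> real"
  assumes "time_scale T" and "a \<in> T" and "b \<in> T" and "a < b" and "0 < \<epsilon>"
    and "regular_problem T a b L \<phi>"
    and "transformation_family T a b \<phi> \<epsilon> h"
    and "invariant_up_to T a b L \<phi> \<epsilon> h \<Phi>"
  shows "\<forall>x u lam p. extremal T a b L \<phi> x u lam p \<longrightarrow>
           (\<lambda>t. p t * deriv (\<lambda>s. h s t (x t) (u t)) 0
                + lam * deriv (\<lambda>s. \<Phi> s t (x t) (u t)) 0)
             constant_on (ts_ival T a b)"
  using noether_constant_on[OF assms] by blast

end
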